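(* Let $q\ge 5$ and $d\ge 0$ be integers, and let $T$ be the complete $q$-ary tree of depth $d$. Then $\Phi_V(T)=d$.
   Context: The complete $q$-ary tree of depth $d$ is the rooted tree in which every vertex at distance less than $d$ from the root has exactly $q$ children, and the vertices at distance $d$ from the root are leaves. For a graph $G$ and $S\subseteq V(G)$, the vertex-border is $\delta(S)=\{v\in V(G)\setminus S : N(v)\cap S\neq\emptyset\}$. The vertex-isoperimetric parameter is $\Phi_V(G,s)=\min_{S\subseteq V(G),\,|S|=s}|\delta(S)|$, and the vertex-isoperimetric peak is $\Phi_V(G)=\max_{0\le s\le |V(G)|}\Phi_V(G,s)$. *)

theory Defs
  imports "Graph_Theory.Graph_Theory"
begin

text \<open>A finite simple graph is a symmetric digraph satisfying the locale \<^locale>\<open>graph\<close> of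
  Graph_Theory.\<close>

definition nbhd :: "('a, 'b) pre_digraph \<Rightarrow> 'a \<Rightarrow> 'a set" where
  "nbhd G v = {u. v \<rightarrow>\<^bsub>G\<^esub> u}"

definition vertex_border :: "('a, 'b) pre_digraph \<Rightarrow> 'a set \<Rightarrow> 'a set" where
  "vertex_border G S = {v \<in> verts G - S. nbhd G v \<inter> S \<noteq> {}}"

definition vertex_iso_param :: "('a, 'b) pre_digraph \<Rightarrow> nat \<Rightarrow> nat" where
  "vertex_iso_param G s = Min {card (vertex_border G S) | S. S \<subseteq> verts G \<and> card S = s}"

definition vertex_iso_peak :: "('a, 'b) pre_digraph \<Rightarrow> nat" where
  "vertex_iso_peak G = Max {vertex_iso_param G s | s. 0 \<le> s \<and> s \<le> card (verts G)}"

text \<open>The library's \<^const>\<open>tree\<close> also excludes the cycles \<open>u, v, u\<close>, which are present at every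
  edge of a symmetric digraph; as usual for undirected graphs, a cycle has at least three edges.\<close>

definition is_tree :: "('a, 'b) pre_digraph \<Rightarrow> bool" where
  "is_tree G \<longleftrightarrow> graph G \<and> connected G \<and> \<not> (\<exists>p. pre_digraph.cycle G p \<and> 3 \<le> length p)"

definition graph_dist :: "('a, 'b) pre_digraph \<Rightarrow> 'a \<Rightarrow> 'a \<Rightarrow> ereal" where
  "graph_dist G u v = wf_digraph.\<mu> G (\<lambda>_. 1) u v"

definition children :: "('a, 'b) pre_digraph \<Rightarrow> 'a \<Rightarrow> 'a \<Rightarrow> 'a set" where
  "children G r v = {w \<in> nbhd G v. graph_dist G r w = graph_dist G r v + 1}"

text \<open>A leaf of a rooted tree is a vertex without children, so that the root is a leaf exactly
  if it is the only vertex. By connectedness, no vertex is at distance more than \<open>d\<close> from the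
  root.\<close>

definition complete_qary_tree :: "nat \<Rightarrow> nat \<Rightarrow> ('a, 'b) pre_digraph \<Rightarrow> 'a \<Rightarrow> bool" where
  "complete_qary_tree q d G r \<longleftrightarrow>
     is_tree G \<and> r \<in> verts G \<and>
     (\<forall>v \<in> verts G. graph_dist G r v < ereal (real d) \<longrightarrow> card (children G r v) = q) \<and>
     (\<forall>v \<in> verts G. graph_dist G r v = ereal (real d) \<longrightarrow> children G r v = {})"

text \<open>The definition is satisfiable: the words of length at most \<open>d\<close> over \<open>q\<close> letters.\<close>

definition word_tree :: "nat \<Rightarrow> nat \<Rightarrow> nat list pair_pre_digraph" where
  "word_tree q d =
     (let V = {w. set w \<subseteq> {..<q} \<and> length w \<le> d}
      in \<lparr>pverts = V,
          parcs = {(u, v). u \<in> V \<and> v \<in> V \<and> ((\<exists>i. v = u @ [i]) \<or> (\<exists>i. u = v @ [i]))}\<rparr>)"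

lemma pverts_word_tree: "pverts (word_tree q d) = {w. set w \<subseteq> {..<q} \<and> length w \<le> d}"
  by (simp add: word_tree_def Let_def)

lemma parcs_word_tree:
  "(u, v) \<in> parcs (word_tree q d) \<longleftrightarrow> u \<in> pverts (word_tree q d) \<and> v \<in> pverts (word_tree q d) \<and>
     ((\<exists>i. v = u @ [i]) \<or> (\<exists>i. u = v @ [i]))"
  by (simp add: word_tree_def Let_def)

lemma pair_graph_word_tree: "pair_graph (word_tree q d)"
proof -
  have fin: "finite (pverts (word_tree q d))"
    unfolding pverts_word_tree by (rule finite_lists_length_le) simp
  have sub: "parcs (word_tree q d) \<subseteq> pverts (word_tree q d) \<times> pverts (word_tree q d)"
    by (auto simp: parcs_word_tree)
  show ?thesis
  proof
    show "finite (parcs (word_tree q d))"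
      using finite_subset[OF sub] fin by blast
    show "symmetric (with_proj (word_tree q d))"
      by (auto simp: symmetric_def sym_def parcs_word_tree)
    fix e assume "e \<in> parcs (word_tree q d)"
    then show "fst e \<noteq> snd e" by (cases e) (auto simp: parcs_word_tree)
  qed (use fin sub in auto)
qed

interpretation WT: pair_graph "word_tree q d" for q d
  by (rule pair_graph_word_tree)

lemma word_tree_walk_length:
  "WT.awalk q d u p v \<Longrightarrow> length v \<le> length u + length p"
proof (induction p arbitrary: u)
  case (Cons e p)
  then show ?case
    by (cases e) (force simp: WT.awalk_Cons_iff parcs_word_tree)
qed (auto simp: WT.awalk_Nil_iff)

lemma word_tree_walk_ex:
  "w \<in> pverts (word_tree q d) \<Longrightarrow> \<exists>p. WT.awalk q d [] p w \<and> length p = length w"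
proof (induction w rule: rev_induct)
  case Nil
  then show ?case by (intro exI[of _ "[]"]) (simp add: WT.awalk_Nil_iff)
next
  case (snoc i w)
  then have w: "w \<in> pverts (word_tree q d)" by (simp add: pverts_word_tree)
  then obtain p where p: "WT.awalk q d [] p w" "length p = length w" using snoc by blast
  have "WT.awalk q d w [(w, w @ [i])] (w @ [i])"
    using w snoc.prems by (simp add: WT.awalk_Cons_iff WT.awalk_Nil_iff parcs_word_tree)
  then show ?case
    using p WT.awalk_appendI by (intro exI[of _ "p @ [(w, w @ [i])]"]) auto
qed

lemma graph_dist_word_tree:
  assumes "w \<in> pverts (word_tree q d)"
  shows "graph_dist (with_proj (word_tree q d)) [] w = ereal (real (length w))"
proof -
  have cost: "WT.awalk_cost (\<lambda>_. 1) p = real (length p)" for p :: "(nat list \<times> nat list) list"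
    by (induction p) (auto simp: WT.awalk_cost_def)
  obtain p where p: "WT.awalk q d [] p w" "length p = length w"
    using word_tree_walk_ex[OF assms] by blast
  show ?thesis
    unfolding graph_dist_def WT.\<mu>_def cost
    by (rule antisym) (use p in \<open>auto intro!: INF_lower2[of p] INF_greatest dest: word_tree_walk_length\<close>)
qed

lemma children_word_tree:
  assumes "v \<in> pverts (word_tree q d)"
  shows "children (with_proj (word_tree q d)) [] v =
    (if length v < d then (\<lambda>i. v @ [i]) ` {..<q} else {})"
proof -
  have "w \<in> children (with_proj (word_tree q d)) [] v \<longleftrightarrow>
      w \<in> pverts (word_tree q d) \<and> (\<exists>i. w = v @ [i])" for w
  proof (cases "w \<in> pverts (word_tree q d)")
    case True
    then show ?thesis
      using assms
      by (auto simp: children_def nbhd_def parcs_word_tree graph_dist_word_tree one_ereal_def)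
  qed (auto simp: children_def nbhd_def parcs_word_tree)
  then show ?thesis
    using assms by (auto simp: pverts_word_tree)
qed

lemma connected_word_tree: "connected (with_proj (word_tree q d))"
proof -
  have "strongly_connected (with_proj (word_tree q d))"
  proof
    have "[] \<in> pverts (word_tree q d)" by (simp add: pverts_word_tree)
    then show "verts (with_proj (word_tree q d)) \<noteq> {}" by auto
    fix u v
    assume "u \<in> verts (with_proj (word_tree q d))" "v \<in> verts (with_proj (word_tree q d))"
    then obtain p p' where "WT.awalk q d [] p u" "WT.awalk q d [] p' v"
      using word_tree_walk_ex by fastforce
    then have "WT.awalk q d u (rev_path p @ p') v"
      using WT.awalk_appendI WT.awalk_rev_path by metis
    then show "u \<rightarrow>\<^sup>*\<^bsub>with_proj (word_tree q d)\<^esub> v"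
      using WT.reachable_awalk by metis
  qed
  then show ?thesis
    unfolding connected_def strongly_connected_def
    using WT.reachable_mk_symmetric_eq[OF WT.sym_arcs] by simp
qed

lemma acyclic_word_tree:
  assumes "WT.cycle q d p" shows "length p < 3"
proof (rule ccontr)
  assume "\<not> length p < 3"
  obtain u where u: "WT.awalk q d u p u" "distinct (tl (pawalk_verts u p))" "p \<noteq> []"
    using assms by (auto simp: WT.cycle_def)
  have snds: "tl (pawalk_verts u p) = map snd p" if "pcas u p v" for u v p
    using that
  proof (induction p arbitrary: u)
    case (Cons e p)
    then show ?case by (cases p) auto
  qed simp
  have dist: "distinct (map snd p)"
    using u snds by (metis WT.awalkE)
  let ?V = "set (pawalk_verts u p)"
  have "u \<in> ?V" by (cases p) (use u in \<open>auto simp: WT.awalk_Cons_iff\<close>)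
  then have ne: "length ` ?V \<noteq> {}" by auto
  obtain w where w: "w \<in> ?V" "length w = Max (length ` ?V)"
    using Max_in[OF finite_imageI[OF finite_set] ne] by (metis imageE)
  then have max: "length x \<le> length w" if "x \<in> ?V" for x
    using that by simp
  obtain q' r where qr: "p = q' @ r" "WT.awalk q d w (r @ q') w"
    "set (pawalk_verts w (r @ q')) = ?V"
    using WT.rotate_awalkE[OF u(1) w(1)] by blast
  have "distinct (map snd (r @ q'))" "3 \<le> length (r @ q')"
    using dist qr(1) \<open>\<not> length p < 3\<close> by auto
  then obtain e es where e: "r @ q' = e # es" "2 \<le> length es" "distinct (map snd (e # es))"
    by (cases "r @ q'") auto
  then obtain mid f where mid: "es = mid @ [f]" "mid \<noteq> []"
    by (cases es rule: rev_cases) (auto simp: Suc_le_eq)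
  obtain mid' g where g: "mid = mid' @ [g]"
    using mid(2) by (cases mid rule: rev_cases) auto
  have walk: "WT.awalk q d w (e # mid' @ [g, f]) w"
    using qr(2) e(1) mid g by simp
  have verts: "set (pawalk_verts w (e # mid' @ [g, f])) = ?V"
    using qr(3) e(1) mid g by simp
  have e': "fst e = w" "e \<in> parcs (word_tree q d)"
    using walk by (auto simp: WT.awalk_Cons_iff)
  have f': "snd g = fst f" "snd f = w" "f \<in> parcs (word_tree q d)"
    using walk by (auto simp: WT.awalk_Cons_iff WT.awalk_append_iff WT.awalk_Nil_iff)
  have sub: "snd ` set (e # mid' @ [g, f]) \<subseteq> ?V"
  proof -
    have "pcas w (e # mid' @ [g, f]) w" using walk by (auto simp: WT.awalk_def)
    from snds[OF this] show ?thesis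
      using verts by (metis list.set_map list.set_sel(2) pawalk_verts.simps(2) list.distinct(1) subsetI)
  qed
  have "length (snd e) \<le> length w" "length (snd g) \<le> length w"
    using sub max by auto
  then have "snd e = butlast w" "snd g = butlast w"
    using e' f' by (cases e; cases f; auto simp: parcs_word_tree)+
  then show False
    using e(3) mid g by simp
qed

lemma complete_qary_tree_word_tree:
  "complete_qary_tree q d (with_proj (word_tree q d)) []"
proof -
  have "is_tree (with_proj (word_tree q d))"
    unfolding is_tree_def
    using WT.pair_graphD_graph connected_word_tree acyclic_word_tree by (auto simp: not_le)
  moreover have "card ((\<lambda>i. v @ [i]) ` {..<q}) = q" for v :: "nat list"
    by (subst card_image) (auto simp: inj_on_def)
  ultimately show ?thesis
    by (auto simp: complete_qary_tree_def graph_dist_word_tree children_word_tree)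
       (auto simp: pverts_word_tree)
qed

end

theory Submission
  imports Defs
begin

text \<open>A set \<open>S\<close> of vertices that is an initial segment of the postorder has a border contained in a
  single root path without its leaf, so every size admits a border of at most \<open>d\<close> vertices.

  For the converse let \<open>S\<close> have \<open>S\<^sub>i\<close> vertices and its border \<open>b\<^sub>i\<close> vertices at depth \<open>i\<close>. Counting
  parents and children gives \<open>S\<^sub>i\<^sub>+\<^sub>1 \<le> q (S\<^sub>i + b\<^sub>i)\<close> and \<open>q S\<^sub>i \<le> S\<^sub>i\<^sub>+\<^sub>1 + b\<^sub>i\<^sub>+\<^sub>1\<close>. Take
  \<open>|S| = L\<^sub>0 + \<dots> + L\<^sub>d\<close> where \<open>L\<^sub>0 = 0\<close> and \<open>L\<^sub>i\<^sub>+\<^sub>1 = 2 + q L\<^sub>i\<close>. The deviations \<open>x\<^sub>i = S\<^sub>i - L\<^sub>i\<close> then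
  have sum zero and satisfy \<open>x\<^sub>i\<^sub>+\<^sub>1 + 2 \<le> q (x\<^sub>i + b\<^sub>i)\<close> and \<open>q x\<^sub>i \<le> x\<^sub>i\<^sub>+\<^sub>1 + 2 + b\<^sub>i\<^sub>+\<^sub>1\<close>. A
  vanishing deviation forces \<open>b\<^sub>i \<ge> 1\<close>, and for \<open>q \<ge> 5\<close> nonzero deviations cost at least as many
  border vertices elsewhere as they save.\<close>

section \<open>Complete trees as trees of words\<close>

context sym_digraph
begin

text \<open>Each arc has some opposite arc, and replacing the arcs one at a time retraces the same
  vertices. This is used to turn a walk from the root into a walk back to it.\<close>

lemma awalk_reverse_verts:
  assumes "awalk u p v"
  shows "\<exists>p'. awalk v p' u \<and> set (awalk_verts v p') = set (awalk_verts u p)"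
  using assms
proof (induction p arbitrary: u)
  case Nil
  then show ?case by (intro exI[of _ "[]"]) (auto simp: awalk_Nil_iff)
next
  case (Cons e p)
  then have e: "e \<in> arcs G" "u = tail G e" and p: "awalk (head G e) p v"
    by (auto simp: awalk_Cons_iff)
  obtain p' where p': "awalk v p' (head G e)"
    "set (awalk_verts v p') = set (awalk_verts (head G e) p)"
    using Cons.IH[OF p] by blast
  have "head G e \<rightarrow> tail G e"
    by (rule graph_symmetric) (use e(1) in \<open>auto simp: arcs_ends_def arc_to_ends_def\<close>)
  then obtain e' where e': "e' \<in> arcs G" "tail G e' = head G e" "head G e' = tail G e"
    by (auto simp: arcs_ends_def arc_to_ends_def)
  have w: "awalk (head G e) [e'] u"
    using e e' by (auto simp: awalk_simps)
  have "head G e \<in> set (awalk_verts (head G e) p)" using hd_in_awalk_verts(1)[OF p] .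
  then have "set (awalk_verts v (p' @ [e'])) = set (awalk_verts u (e # p))"
    using set_awalk_verts_append[OF p'(1) w] p'(2) e e' by auto
  then show ?case using awalk_appendI[OF p'(1) w] by blast
qed

text \<open>Shortening the walk to a path keeps it away from \<open>w\<close>. It has at least one
  arc because \<open>u\<close> and \<open>v\<close> differ, so closing it through \<open>w\<close>
  gives a cycle with three or more arcs.\<close>

lemma ex_cycle_through:
  assumes "w \<rightarrow> u" "w \<rightarrow> v" "u \<noteq> v" "awalk u p v" "w \<notin> set (awalk_verts u p)"
  shows "\<exists>c. cycle c \<and> 3 \<le> length c"
proof -
  define a where "a = awalk_to_apath p"
  have "apath u a v" "set a \<subseteq> set p"
    using apath_awalk_to_apath[OF assms(4)] awalk_to_apath_subset[OF assms(4)] by (simp_all add: a_def)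
  then have a: "awalk u a v" "distinct (awalk_verts u a)" by (simp_all add: apath_def)
  have w: "w \<notin> set (awalk_verts u a)"
    using assms(5) \<open>set a \<subseteq> set p\<close>
    unfolding set_awalk_verts[OF assms(4)] set_awalk_verts[OF a(1)] by auto
  have "a \<noteq> []" using a(1) assms(3) by (auto simp: awalk_Nil_iff)
  obtain e where e: "e \<in> arcs G" "tail G e = w" "head G e = u"
    using assms(1) by (auto simp: arcs_ends_def arc_to_ends_def)
  obtain f where f: "f \<in> arcs G" "tail G f = v" "head G f = w"
    using graph_symmetric[OF assms(2)] by (auto simp: arcs_ends_def arc_to_ends_def)
  have f': "awalk v [f] w" using f by (auto simp: awalk_simps)
  have af: "awalk u (a @ [f]) w" using awalk_appendI[OF a(1) f'] .
  have walk: "awalk w (e # a @ [f]) w" using af e by (auto simp: awalk_Cons_iff)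
  have "awalk_verts u (a @ [f]) = awalk_verts u a @ [w]"
    using awalk_verts_append[OF af] f a(1) by auto
  then have "distinct (tl (awalk_verts w (e # a @ [f])))"
    using a w e by simp
  then have "cycle (e # a @ [f])" using walk unfolding cycle_def by blast
  moreover have "3 \<le> length (e # a @ [f])" using \<open>a \<noteq> []\<close> by (cases a) auto
  ultimately show ?thesis by blast
qed

end

section \<open>Distances from the root as natural numbers\<close>

text \<open>A counterpart of the extended-real \<open>graph_dist\<close> that permits induction on
  depth. Without a walk the \<open>LEAST\<close> is unspecified, hence the reachability assumptions
  below.\<close>

definition hop_dist :: "('a, 'b) pre_digraph \<Rightarrow> 'a \<Rightarrow> 'a \<Rightarrow> nat" where
  "hop_dist G u v = (LEAST n. \<exists>p. pre_digraph.awalk G u p v \<and> length p = n)"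

context wf_digraph
begin

lemma hop_dist_le: "awalk u p v \<Longrightarrow> hop_dist G u v \<le> length p"
  unfolding hop_dist_def by (rule Least_le) blast

lemma ex_awalk_hop_dist:
  assumes "u \<rightarrow>\<^sup>* v"
  shows "\<exists>p. awalk u p v \<and> length p = hop_dist G u v"
  using assms LeastI_ex[of "\<lambda>n. \<exists>p. awalk u p v \<and> length p = n"]
  unfolding hop_dist_def reachable_awalk by blast

lemma graph_dist_eq_hop_dist:
  assumes "u \<rightarrow>\<^sup>* v"
  shows "graph_dist G u v = ereal (real (hop_dist G u v))"
proof -
  have cost: "awalk_cost (\<lambda>_. 1) p = real (length p)" for p
    by (induction p) auto
  obtain p where "awalk u p v" "length p = hop_dist G u v"
    using ex_awalk_hop_dist[OF assms] by blast
  then show ?thesis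
    unfolding graph_dist_def \<mu>_def cost
    by (intro antisym) (auto intro!: INF_lower2[of p] INF_greatest dest: hop_dist_le)
qed

lemma hop_dist_self: "u \<in> verts G \<Longrightarrow> hop_dist G u u = 0"
  using hop_dist_le[of u "[]" u] by (simp add: awalk_Nil_iff)

lemma hop_dist_eq_0:
  assumes "u \<rightarrow>\<^sup>* v" "hop_dist G u v = 0"
  shows "v = u"
  using ex_awalk_hop_dist[OF assms(1)] assms(2) by (auto simp: awalk_Nil_iff)

lemma hop_dist_arc_le:
  assumes "u \<rightarrow>\<^sup>* v" "v \<rightarrow> w"
  shows "hop_dist G u w \<le> Suc (hop_dist G u v)"
proof -
  obtain p where p: "awalk u p v" "length p = hop_dist G u v"
    using ex_awalk_hop_dist[OF assms(1)] by blast
  obtain e where "e \<in> arcs G" "tail G e = v" "head G e = w"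
    using assms(2) by (auto simp: arcs_ends_def arc_to_ends_def)
  then have "awalk v [e] w" by (auto simp: awalk_simps)
  from hop_dist_le[OF awalk_appendI[OF p(1) this]] show ?thesis using p(2) by simp
qed

lemma ex_closer_neighbour:
  assumes "u \<rightarrow>\<^sup>* v" "hop_dist G u v = Suc n"
  shows "\<exists>w. u \<rightarrow>\<^sup>* w \<and> w \<rightarrow> v \<and> hop_dist G u w = n"
proof -
  obtain p where p: "awalk u p v" "length p = Suc n"
    using ex_awalk_hop_dist[OF assms(1)] assms(2) by auto
  then obtain p' e where pe: "p = p' @ [e]" by (cases p rule: rev_cases) auto
  define w where "w = tail G e"
  have w: "awalk u p' w" "w \<rightarrow> v"
    using p(1) by (auto simp: pe w_def awalk_simps arcs_ends_def arc_to_ends_def)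
  have uw: "u \<rightarrow>\<^sup>* w" using w(1) reachable_awalk by blast
  have "hop_dist G u w \<le> n" using hop_dist_le[OF w(1)] p(2) pe by simp
  moreover have "Suc n \<le> Suc (hop_dist G u w)" using hop_dist_arc_le[OF uw w(2)] assms(2) by simp
  ultimately show ?thesis using w uw by auto
qed

text \<open>On a shortest walk, any vertex other than the end is reached by a proper prefix, which
  is a strictly shorter walk.\<close>

lemma ex_awalk_closer:
  assumes "u \<rightarrow>\<^sup>* v"
  shows "\<exists>p. awalk u p v \<and> (\<forall>w \<in> set (awalk_verts u p). w = v \<or> hop_dist G u w < hop_dist G u v)"
proof -
  obtain p where p: "awalk u p v" "length p = hop_dist G u v"
    using ex_awalk_hop_dist[OF assms] by blast
  have "w = v \<or> hop_dist G u w < hop_dist G u v" if w: "w \<in> set (awalk_verts u p)" for w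
  proof -
    obtain p1 p2 where d: "p = p1 @ p2" "awalk u p1 w" "awalk w p2 v"
      using awalk_decomp[OF p(1) w] by blast
    show ?thesis
    proof (cases p2)
      case Nil
      then show ?thesis using d by (auto simp: awalk_Nil_iff)
    next
      case (Cons e p3)
      then show ?thesis using hop_dist_le[OF d(2)] d(1) p(2) by simp
    qed
  qed
  then show ?thesis using p(1) by blast
qed

end

section \<open>Unique parents and the labelling of vertices by words\<close>

text \<open>Apart from their ends, shortest walks from \<open>r\<close> to \<open>u\<close> and
  \<open>v\<close> stay strictly closer to \<open>r\<close> than \<open>w\<close>, so joined at
  \<open>r\<close> they avoid \<open>w\<close>. Two distinct such neighbours would thus close a
  cycle. Equal distances are allowed, which also rules out edges within a level.\<close>

lemma (in graph) tree_closer_neighbour_unique: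
  assumes tree: "is_tree G" and reach: "r \<rightarrow>\<^sup>* u" "r \<rightarrow>\<^sup>* v"
    and adj: "w \<rightarrow> u" "w \<rightarrow> v"
    and dist: "hop_dist G r u \<le> hop_dist G r w" "hop_dist G r v \<le> hop_dist G r w"
  shows "u = v"
proof (rule ccontr)
  assume "u \<noteq> v"
  obtain p where p: "awalk r p u"
    "\<And>x. x \<in> set (awalk_verts r p) \<Longrightarrow> x = u \<or> hop_dist G r x < hop_dist G r u"
    using ex_awalk_closer[OF reach(1)] by blast
  obtain p' where p': "awalk r p' v"
    "\<And>x. x \<in> set (awalk_verts r p') \<Longrightarrow> x = v \<or> hop_dist G r x < hop_dist G r v"
    using ex_awalk_closer[OF reach(2)] by blast
  obtain m where m: "awalk u m r" "set (awalk_verts u m) = set (awalk_verts r p)"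
    using awalk_reverse_verts[OF p(1)] by blast
  have "w \<noteq> u" "w \<noteq> v" using adj adj_not_same by blast+
  then have "w \<notin> set (awalk_verts u (m @ p'))"
    using set_awalk_verts_append[OF m(1) p'(1)] m(2) p(2)[of w] p'(2)[of w] dist by auto
  then show False
    using ex_cycle_through[OF adj \<open>u \<noteq> v\<close> awalk_appendI[OF m(1) p'(1)]] tree
    by (auto simp: is_tree_def)
qed

text \<open>Numbering the children of every inner vertex turns a word into a descent from the root.
  Uniqueness of parents gives injectivity and the absence of further edges; induction on depth gives
  surjectivity.\<close>

lemma complete_qary_tree_iso_word_tree:
  assumes "complete_qary_tree q d T r"
  obtains \<phi> where "bij_betw \<phi> (pverts (word_tree q d)) (verts T)"
    and "\<And>u v. u \<in> pverts (word_tree q d) \<Longrightarrow> v \<in> pverts (word_tree q d) \<Longrightarrow>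
      \<phi> u \<rightarrow>\<^bsub>T\<^esub> \<phi> v \<longleftrightarrow> u \<rightarrow>\<^bsub>with_proj (word_tree q d)\<^esub> v"
proof -
  let ?W = "pverts (word_tree q d)"
  have tree: "is_tree T" and r: "r \<in> verts T" using assms by (auto simp: complete_qary_tree_def)
  interpret graph T using tree by (simp add: is_tree_def)
  have "strongly_connected T"
    using tree sym_arcs symmetric_connected_imp_strongly_connected by (simp add: is_tree_def)
  then have reach: "r \<rightarrow>\<^sup>*\<^bsub>T\<^esub> v" if "v \<in> verts T" for v using r that by auto
  define D where "D = hop_dist T r"
  have adj_verts: "u \<in> verts T" "v \<in> verts T" if "u \<rightarrow>\<^bsub>T\<^esub> v" for u v
    using that adj_in_verts by auto
  have children: "children T r v = {w. v \<rightarrow>\<^bsub>T\<^esub> w \<and> D w = Suc (D v)}" if "v \<in> verts T" for v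
    using that adj_verts
    by (auto simp: children_def nbhd_def graph_dist_eq_hop_dist[OF reach] D_def one_ereal_def)
  have card: "card (children T r v) = q" if "v \<in> verts T" "D v < d" for v
    using assms that by (auto simp: complete_qary_tree_def graph_dist_eq_hop_dist[OF reach] D_def)
  have leaf: "children T r v = {}" if "v \<in> verts T" "D v = d" for v
    using assms that by (auto simp: complete_qary_tree_def graph_dist_eq_hop_dist[OF reach] D_def)
  have unique: "u = v" if "w \<rightarrow>\<^bsub>T\<^esub> u" "w \<rightarrow>\<^bsub>T\<^esub> v" "D u \<le> D w" "D v \<le> D w" for u v w
    using tree_closer_neighbour_unique[OF tree reach reach] that adj_verts by (auto simp: D_def)
  have "\<exists>f. bij_betw f {..<q} (children T r v)" if "v \<in> verts T" "D v < d" for v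
  proof -
    have "finite (children T r v)"
      by (rule finite_subset[of _ "verts T"]) (use that adj_verts children in auto)
    then show ?thesis using ex_bij_betw_nat_finite card[OF that] atLeast0LessThan by metis
  qed
  then obtain ch where ch: "bij_betw (ch v) {..<q} (children T r v)"
    if "v \<in> verts T" "D v < d" for v
    by metis
  define \<phi> where "\<phi> = foldl ch r"
  have \<phi>_snoc: "\<phi> (w @ [i]) = ch (\<phi> w) i" for w i by (simp add: \<phi>_def)
  have \<phi>: "\<phi> w \<in> verts T \<and> D (\<phi> w) = length w" if "w \<in> ?W" for w
    using that
  proof (induction w rule: rev_induct)
    case Nil
    then show ?case using r hop_dist_self by (simp add: \<phi>_def D_def)
  next
    case (snoc i w)
    then have w: "\<phi> w \<in> verts T" "D (\<phi> w) = length w" "length w < d" "i < q"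
      by (auto simp: pverts_word_tree)
    then have "ch (\<phi> w) i \<in> children T r (\<phi> w)"
      using bij_betwE[OF ch[of "\<phi> w"]] by auto
    then show ?case using w children adj_verts by (auto simp: \<phi>_snoc)
  qed
  have arc: "\<phi> w \<rightarrow>\<^bsub>T\<^esub> \<phi> (w @ [i])" if "w @ [i] \<in> ?W" for w i
  proof -
    have w: "\<phi> w \<in> verts T" "D (\<phi> w) < d" "i < q"
      using that \<phi>[of w] by (auto simp: pverts_word_tree)
    then have "ch (\<phi> w) i \<in> children T r (\<phi> w)"
      using bij_betwE[OF ch[of "\<phi> w"]] by auto
    then show ?thesis using w children by (auto simp: \<phi>_snoc)
  qed
  have inj: "w = w'" if "w \<in> ?W" "w' \<in> ?W" "\<phi> w = \<phi> w'" for w w'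
    using that
  proof (induction w arbitrary: w' rule: rev_induct)
    case Nil
    have "length w' = length ([] :: nat list)"
      using \<phi>[THEN conjunct2, OF Nil(1)] \<phi>[THEN conjunct2, OF Nil(2)]
      unfolding Nil(3) by simp
    then show ?case by simp
  next
    case (snoc i w)
    have "length w' = Suc (length w)"
      using \<phi>[THEN conjunct2, OF snoc.prems(1)] \<phi>[THEN conjunct2, OF snoc.prems(2)]
      unfolding snoc.prems(3) by simp
    then obtain u j where u: "w' = u @ [j]" by (cases w' rule: rev_cases) auto
    have W: "w \<in> ?W" "u \<in> ?W" "i < q" "j < q" "length w < d"
      using snoc.prems u by (auto simp: pverts_word_tree)
    \<comment> \<open>Both are neighbours one level above the common image of the two words. Once
      the parents agree, injectivity of \<open>ch\<close> identifies the last letters.\<close>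
    have "\<phi> w = \<phi> u"
    proof (rule unique)
      show "\<phi> (w @ [i]) \<rightarrow>\<^bsub>T\<^esub> \<phi> w" using arc snoc.prems(1) graph_symmetric by blast
      show "\<phi> (w @ [i]) \<rightarrow>\<^bsub>T\<^esub> \<phi> u"
        using arc[of u j] snoc.prems(2,3) graph_symmetric u by simp
      show "D (\<phi> w) \<le> D (\<phi> (w @ [i]))" "D (\<phi> u) \<le> D (\<phi> (w @ [i]))"
        using \<phi>[OF snoc.prems(1)] \<phi>[OF W(1)] \<phi>[OF W(2)] \<open>length w' = _\<close> u by auto
    qed
    then have "w = u" using snoc.IH W by blast
    moreover have "inj_on (ch (\<phi> w)) {..<q}"
      using ch[of "\<phi> w"] \<phi>[OF W(1)] W(5) by (auto simp: bij_betw_def)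
    ultimately show ?case
      using snoc.prems(3) W u by (auto simp: \<phi>_snoc inj_on_def)
  qed
  have "\<exists>w \<in> ?W. \<phi> w = v" if "v \<in> verts T" "D v = n" for v n
    using that
  proof (induction n arbitrary: v)
    case 0
    then have "v = r" using hop_dist_eq_0[OF reach] by (simp add: D_def)
    then show ?case by (intro bexI[of _ "[]"]) (auto simp: \<phi>_def pverts_word_tree)
  next
    case (Suc n)
    obtain u where u: "u \<rightarrow>\<^bsub>T\<^esub> v" "D u = n"
      using ex_closer_neighbour[OF reach] Suc.prems by (auto simp: D_def)
    have uT: "u \<in> verts T" using adj_verts u(1) by blast
    then obtain w where w: "w \<in> ?W" "\<phi> w = u" using Suc.IH u by blast
    have v: "v \<in> children T r u" using children[OF uT] u Suc.prems by simp
    \<comment> \<open>Only here does the leaf condition enter: it keeps \<open>w\<close> shorter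
      than \<open>d\<close>, so that \<open>w @ [i]\<close> is again a word of the tree.\<close>
    then have "D u \<noteq> d" using leaf[OF uT] by auto
    moreover have "D u \<le> d" using \<phi>[OF w(1)] w by (auto simp: pverts_word_tree)
    ultimately have "D u < d" by simp
    then have "v \<in> ch u ` {..<q}"
      using ch[OF uT] v by (simp add: bij_betw_def)
    then obtain i where "i < q" "ch u i = v" by auto
    then show ?case
      using w \<phi>[OF w(1)] \<open>D u < d\<close>
      by (intro bexI[of _ "w @ [i]"]) (auto simp: \<phi>_snoc pverts_word_tree)
  qed
  then have bij: "bij_betw \<phi> ?W (verts T)"
    using inj \<phi> by (force simp: bij_betw_def inj_on_def)
  \<comment> \<open>The parent of \<open>\<phi> v\<close> and \<open>\<phi> u\<close> are both
    neighbours of \<open>\<phi> v\<close> that are no deeper than it, so they coincide.\<close>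
  have descend: "\<exists>i. v = u @ [i]" if "u \<in> ?W" "v \<in> ?W" "\<phi> u \<rightarrow>\<^bsub>T\<^esub> \<phi> v" "length u \<le> length v" for u v
  proof (cases v rule: rev_cases)
    case Nil
    then have "u = v" using that by simp
    then show ?thesis using that(3) adj_not_same by blast
  next
    case (snoc w i)
    have w: "w \<in> ?W" using that snoc by (auto simp: pverts_word_tree)
    have "\<phi> u = \<phi> w"
    proof (rule unique)
      show "\<phi> v \<rightarrow>\<^bsub>T\<^esub> \<phi> u" using that graph_symmetric by blast
      show "\<phi> v \<rightarrow>\<^bsub>T\<^esub> \<phi> w" using arc that(2) snoc graph_symmetric by blast
    qed (use \<phi> w that snoc in auto)
    then show ?thesis using inj w that snoc by auto
  qed
  have "\<phi> u \<rightarrow>\<^bsub>T\<^esub> \<phi> v \<longleftrightarrow> u \<rightarrow>\<^bsub>with_proj (word_tree q d)\<^esub> v" if "u \<in> ?W" "v \<in> ?W" for u v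
  proof
    assume uv: "\<phi> u \<rightarrow>\<^bsub>T\<^esub> \<phi> v"
    then have "\<phi> v \<rightarrow>\<^bsub>T\<^esub> \<phi> u" by (rule graph_symmetric)
    then show "u \<rightarrow>\<^bsub>with_proj (word_tree q d)\<^esub> v"
      using descend[OF that uv] descend[of v u] that nat_le_linear[of "length u" "length v"]
      by (auto simp: parcs_word_tree)
  next
    assume "u \<rightarrow>\<^bsub>with_proj (word_tree q d)\<^esub> v"
    then show "\<phi> u \<rightarrow>\<^bsub>T\<^esub> \<phi> v"
      using that arc graph_symmetric by (auto simp: parcs_word_tree)
  qed
  then show thesis using that bij by blast
qed

text \<open>Only adjacency and cardinalities enter the peak: \<open>\<phi>\<close> carries borders
  to borders, so for each size both minima range over the same set of numbers.\<close>

lemma vertex_iso_peak_cong_bij: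
  assumes bij: "bij_betw \<phi> (verts G) (verts H)"
    and adj: "\<And>u v. u \<in> verts G \<Longrightarrow> v \<in> verts G \<Longrightarrow> \<phi> u \<rightarrow>\<^bsub>H\<^esub> \<phi> v \<longleftrightarrow> u \<rightarrow>\<^bsub>G\<^esub> v"
  shows "vertex_iso_peak H = vertex_iso_peak G"
proof -
  have inj: "inj_on \<phi> (verts G)" and img: "verts H = \<phi> ` verts G"
    using bij by (auto simp: bij_betw_def)
  have border: "vertex_border H (\<phi> ` S) = \<phi> ` vertex_border G S" if "S \<subseteq> verts G" for S
  proof -
    have "\<phi> v \<in> vertex_border H (\<phi> ` S) \<longleftrightarrow> v \<in> vertex_border G S" if v: "v \<in> verts G" for v
    proof -
      have "\<phi> v \<in> \<phi> ` S \<longleftrightarrow> v \<in> S"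
        using inj_on_image_mem_iff[OF inj v \<open>S \<subseteq> verts G\<close>] .
      moreover have "nbhd H (\<phi> v) \<inter> \<phi> ` S \<noteq> {} \<longleftrightarrow> nbhd G v \<inter> S \<noteq> {}"
        using adj[OF v] \<open>S \<subseteq> verts G\<close> by (auto simp: nbhd_def)
      ultimately show ?thesis using v by (simp add: vertex_border_def img)
    qed
    moreover have "vertex_border H (\<phi> ` S) \<subseteq> \<phi> ` verts G" "vertex_border G S \<subseteq> verts G"
      by (auto simp: vertex_border_def img)
    ultimately show ?thesis by blast
  qed
  have card_eq: "card (\<phi> ` S) = card S" if "S \<subseteq> verts G" for S
    using inj_on_subset[OF inj that] by (rule card_image)
  have border_sub: "vertex_border G S \<subseteq> verts G" for S by (auto simp: vertex_border_def)
  have "{card (vertex_border H S) | S. S \<subseteq> verts H \<and> card S = s} =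
      {card (vertex_border G S) | S. S \<subseteq> verts G \<and> card S = s}" for s
  proof (intro set_eqI iffI)
    fix n assume "n \<in> {card (vertex_border H S) | S. S \<subseteq> verts H \<and> card S = s}"
    then obtain S where "S \<subseteq> verts G" "n = card (vertex_border H (\<phi> ` S))" "card (\<phi> ` S) = s"
      unfolding img by (auto simp: subset_image_iff)
    then show "n \<in> {card (vertex_border G S) | S. S \<subseteq> verts G \<and> card S = s}"
      using border card_eq border_sub by auto
  next
    fix n assume "n \<in> {card (vertex_border G S) | S. S \<subseteq> verts G \<and> card S = s}"
    then obtain S where S: "S \<subseteq> verts G" "n = card (vertex_border G S)" "card S = s" by blast
    then show "n \<in> {card (vertex_border H S) | S. S \<subseteq> verts H \<and> card S = s}"
      using border card_eq border_sub img by (intro CollectI exI[of _ "\<phi> ` S"]) auto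
  qed
  then have "vertex_iso_param H s = vertex_iso_param G s" for s
    by (simp add: vertex_iso_param_def)
  then show ?thesis
    using bij_betw_same_card[OF bij] by (simp add: vertex_iso_peak_def)
qed

section \<open>The border in the tree of words\<close>

text \<open>Here \<open>y\<close>, \<open>x\<close>, \<open>x'\<close> are the deviations of three consecutive levels and \<open>b\<close> counts the
  border vertices on the middle one. The weights are chosen so that summing over all levels
  leaves \<open>2 * b \<ge> 2\<close> per level plus terms that are nonnegative because the deviations add up
  to zero.\<close>

lemma border_counts_step:
  fixes x x' y b q :: int
  assumes "5 \<le> q" and L: "x' + 2 \<le> q * (x + b)" and U: "0 < y \<Longrightarrow> q * y \<le> x + 2 + b"
  shows "2 + 2 * max 0 (- x) + 4 * max 0 y \<le> 2 * b + 2 * max 0 x + max 0 (- x')"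
\<comment> \<open>Since \<open>max 0 x - max 0 (- x) = x\<close>, the claim is
  \<open>2 + 4 * max 0 y \<le> 2 * (x + b) + max 0 (- x')\<close>. For \<open>y \<ge> 1\<close> the
  bound \<open>U\<close> gives \<open>2 * (x + b) \<ge> 10 * y - 4 \<ge> 4 * y + 2\<close>.\<close>
proof (cases "0 < y")
  case True
  have "5 * y \<le> q * y" using True assms(1) by (intro mult_right_mono) auto
  then show ?thesis using U[OF True] True by linarith
next
  case False
  have "2 \<le> 2 * (x + b) + max 0 (- x')"
  \<comment> \<open>For \<open>x' \<ge> -1\<close> the bound \<open>L\<close> makes
    \<open>x + b\<close> positive; for \<open>x' \<le> -2\<close> the term \<open>- x'\<close>
    already supplies 2 and outweighs a negative \<open>x + b\<close>.\<close>
  proof (cases "-1 \<le> x'")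
    case True
    then have "0 < q * (x + b)" using L by linarith
    then have "0 < x + b" using assms(1) by (simp add: zero_less_mult_iff)
    then show ?thesis by (simp add: max_def)
  next
    case False
    show ?thesis
    proof (cases "x + b < 0")
      case True
      then have "q * (x + b) \<le> 5 * (x + b)"
        using assms(1) by (intro mult_right_mono_neg) auto
      then show ?thesis using L True False by linarith
    qed (use \<open>\<not> -1 \<le> x'\<close> in \<open>simp add: max_def\<close>)
  qed
  then show ?thesis using False by (simp add: max_def split: if_splits)
qed

lemma border_counts_sum:
  fixes x b :: "nat \<Rightarrow> int" and q :: int
  assumes q: "5 \<le> q"
    and L: "\<And>i. i < d \<Longrightarrow> x (Suc i) + 2 \<le> q * (x i + b i)"
    and U: "\<And>i. i < d \<Longrightarrow> q * x i \<le> x (Suc i) + 2 + b (Suc i)"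
    and b: "\<And>i. 0 \<le> b i"
    and sum: "(\<Sum>i\<le>d. x i) = 0"
  shows "int d \<le> (\<Sum>i\<le>d. b i)"
proof (cases d)
  case 0
  then show ?thesis by (simp add: b)
next
  case (Suc e)
  \<comment> \<open>\<open>y\<close> is the deviation one level up. The value 0 at the root makes
    the guarded bound \<open>U\<close> of the step lemma vacuous there.\<close>
  define p n y where "p i = max 0 (x i)" and "n i = max 0 (- x i)"
    and "y i = (case i of 0 \<Rightarrow> 0 | Suc j \<Rightarrow> x j)" for i
  \<comment> \<open>The trailing terms \<open>n k\<close> and \<open>4 * max 0 (y k)\<close> are
    debts to the next level; the step inequality at \<open>k\<close> settles them and leaves the
    same debts at \<open>Suc k\<close>.\<close>
  have partial: "2 * int k + (\<Sum>i<k. n i + 2 * p i) \<le> 2 * (\<Sum>i<k. b i) + n k + 4 * max 0 (y k)"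
    if "k \<le> d" for k
    using that
  proof (induction k)
    case 0
    then show ?case by (simp add: n_def)
  next
    case (Suc k)
    have "2 + 2 * max 0 (- x k) + 4 * max 0 (y k) \<le> 2 * b k + 2 * max 0 (x k) + max 0 (- x (Suc k))"
    proof (rule border_counts_step[OF q])
      show "x (Suc k) + 2 \<le> q * (x k + b k)" using L Suc.prems by simp
      show "q * y k \<le> x k + 2 + b k" if "0 < y k"
        using U[of "k - 1"] Suc.prems that by (cases k) (auto simp: y_def)
    qed
    then show ?case using Suc by (simp add: p_def n_def y_def)
  qed
  define P N where "P = (\<Sum>i<d. p i)" and "N = (\<Sum>i<d. n i)"
  have "x i = p i - n i" for i by (simp add: p_def n_def)
  then have "x d = N - P"
    using sum by (simp add: P_def N_def sum_subtractf flip: lessThan_Suc_atMost)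
  moreover have "p e \<le> P"
    unfolding P_def by (rule member_le_sum) (auto simp: Suc p_def)
  moreover have "2 * int d + N + 2 * P \<le> 2 * (\<Sum>i<d. b i) + n d + 4 * p e"
    using partial[of d]
    by (simp add: Suc y_def p_def P_def N_def sum.distrib flip: sum_distrib_left)
  \<comment> \<open>The debt \<open>n d + 4 * p e\<close> remains. If \<open>x e > 0\<close>, this
    bound together with \<open>x d = N - P\<close> yields
    \<open>N + b d \<ge> 5 * x e - 2 + P\<close>, which covers it; otherwise
    \<open>N + 2 * P\<close> does.\<close>
  moreover have "0 < x e \<Longrightarrow> 5 * x e \<le> x d + 2 + b d"
    using U[of e] mult_right_mono[OF q, of "x e"] unfolding Suc by linarith
  moreover have "0 \<le> N" "0 \<le> b d" by (auto simp: N_def n_def b intro: sum_nonneg)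
  moreover have "p e = x e \<and> 0 < x e \<or> p e = 0" "n d = - x d \<and> x d \<le> 0 \<or> n d = 0 \<and> 0 \<le> x d"
    by (auto simp: p_def n_def)
  ultimately have "int d \<le> (\<Sum>i<d. b i) + b d"
    by (elim disjE conjE) linarith+
  then show ?thesis by (simp flip: lessThan_Suc_atMost)
qed

section \<open>Sets of words with small border\<close>

abbreviation words :: "nat \<Rightarrow> nat \<Rightarrow> nat list set" where
  "words q d \<equiv> pverts (word_tree q d)"

lemma finite_words: "finite (words q d)"
  unfolding pverts_word_tree by (rule finite_lists_length_le) simp

lemma words_append1_iff: "w @ [i] \<in> words q d \<longleftrightarrow> w \<in> words q d \<and> i < q \<and> length w < d"
  by (auto simp: pverts_word_tree)

lemma vertex_border_word_tree:
  assumes "S \<subseteq> words q d"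
  shows "vertex_border (with_proj (word_tree q d)) S =
    {w \<in> words q d - S. (\<exists>i. w @ [i] \<in> S) \<or> w \<noteq> [] \<and> butlast w \<in> S}"
proof -
  have "nbhd (with_proj (word_tree q d)) w \<inter> S \<noteq> {} \<longleftrightarrow>
      (\<exists>i. w @ [i] \<in> S) \<or> w \<noteq> [] \<and> butlast w \<in> S" if "w \<in> words q d" for w
    using assms that
    by (cases w rule: rev_cases) (auto simp: nbhd_def parcs_word_tree)
  then show ?thesis by (auto simp: vertex_border_def)
qed

lemma words_Suc: "words q (Suc d) = insert [] ((\<lambda>(i, w). i # w) ` ({..<q} \<times> words q d))"
proof (intro set_eqI)
  fix w
  show "w \<in> words q (Suc d) \<longleftrightarrow> w \<in> insert [] ((\<lambda>(i, w). i # w) ` ({..<q} \<times> words q d))"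
    by (cases w) (auto simp: pverts_word_tree)
qed

lemma card_words_Suc: "card (words q (Suc d)) = Suc (q * card (words q d))"
  unfolding words_Suc using finite_words
  by (subst card_insert_disjoint) (auto simp: card_image inj_on_def)

text \<open>Fill whole child subtrees from the left and recurse into the next one with the
  remainder. Each recursion level adds at most one vertex with a child in the set, namely the
  current root.\<close>

lemma ex_descendant_closed_small_border:
  "s \<le> card (words q d) \<Longrightarrow> \<exists>S \<subseteq> words q d. card S = s \<and> ([] \<in> S \<longrightarrow> S = words q d) \<and>
     (\<forall>w\<in>S. \<forall>i. w @ [i] \<in> words q d \<longrightarrow> w @ [i] \<in> S) \<and>
     card {w \<in> words q d - S. \<exists>i. w @ [i] \<in> S} \<le> d"
proof (induction d arbitrary: s)
  case 0
  have W: "words q 0 = {[]}" by (auto simp: pverts_word_tree)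
  consider "s = 0" | "s = 1" using 0 W by fastforce
  then show ?case
  proof cases
    case 1
    then show ?thesis by (intro exI[of _ "{}"]) auto
  next
    case 2
    then show ?thesis by (intro exI[of _ "{[]}"]) (auto simp: W)
  qed
next
  case (Suc d)
  let ?W = "words q d" and ?W' = "words q (Suc d)"
  show ?case
  proof (cases "s = card ?W'")
    case True
    then show ?thesis by (intro exI[of _ ?W']) auto
  next
    case False
    let ?N = "card ?W"
    have "[] \<in> ?W" by (simp add: pverts_word_tree)
    then have N: "0 < ?N" using finite_words card_gt_0_iff by blast
    have s: "s \<le> q * ?N" using Suc.prems False card_words_Suc by simp
    define a where "a = s div ?N"
    have aq: "a \<le> q" using div_le_mono[OF s, of ?N] N by (simp add: a_def)
    have "s mod ?N \<le> ?N" using N by (simp add: less_imp_le)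
    then obtain S where S: "S \<subseteq> ?W" "card S = s mod ?N"
      "\<And>w i. w \<in> S \<Longrightarrow> w @ [i] \<in> ?W \<Longrightarrow> w @ [i] \<in> S"
      "card {w \<in> ?W - S. \<exists>i. w @ [i] \<in> S} \<le> d"
      using Suc.IH by meson
    have finS: "finite S" using S(1) finite_words finite_subset by blast
    \<comment> \<open>\<open>a = q\<close> happens only for \<open>s = q * ?N\<close>, when the
      remainder is empty; so the letter \<open>a\<close> is used only when it is a legal
      one.\<close>
    have Sa: "a < q" if "S \<noteq> {}"
    proof (rule ccontr)
      assume "\<not> a < q"
      then have "a = q" using aq by simp
      then have "s mod ?N = 0" using s div_mult_mod_eq[of s ?N] by (simp add: a_def)
      then show False using S(2) finS that by simp
    qed
    let ?B = "{w \<in> ?W - S. \<exists>i. w @ [i] \<in> S}"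
    define R where "R = (\<lambda>(i, w). i # w) ` ({..<a} \<times> ?W) \<union> (#) a ` S"
    have mem: "j # w \<in> R \<longleftrightarrow> j < a \<and> w \<in> ?W \<or> j = a \<and> w \<in> S" "[] \<notin> R" for j w
      by (auto simp: R_def)
    have sub: "R \<subseteq> ?W'" using aq Sa S(1) by (auto simp: R_def words_Suc)
    have "card R = a * ?N + s mod ?N"
      unfolding R_def using finS finite_words S(2)
      by (subst card_Un_disjoint) (auto simp: card_image inj_on_def)
    then have card: "card R = s" by (simp add: a_def)
    have closed: "w @ [i] \<in> R" if "w \<in> R" "w @ [i] \<in> ?W'" for w i
    proof (cases w)
      case (Cons j u)
      then have "u @ [i] \<in> ?W" using that(2) by (auto simp: pverts_word_tree)
      then show ?thesis using that(1) S(3) Cons by (auto simp: mem)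
    qed (use that mem in auto)
    \<comment> \<open>Subtrees with letter below \<open>a\<close> lie in \<open>R\<close> and those
      above are disjoint from it, so apart from the root only subtree \<open>a\<close>
      contributes.\<close>
    have "{w \<in> ?W' - R. \<exists>i. w @ [i] \<in> R} \<subseteq> insert [] ((#) a ` ?B)"
    proof
      fix w assume w: "w \<in> {w \<in> ?W' - R. \<exists>i. w @ [i] \<in> R}"
      then obtain i where i: "w @ [i] \<in> R" by blast
      show "w \<in> insert [] ((#) a ` ?B)"
      proof (cases w)
        case (Cons j u)
        then have "u \<in> ?W" using w by (auto simp: pverts_word_tree)
        then show ?thesis using w i Cons by (auto simp: mem)
      qed simp
    qed
    then have "card {w \<in> ?W' - R. \<exists>i. w @ [i] \<in> R} \<le> card (insert [] ((#) a ` ?B))"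
      by (rule card_mono[rotated]) (simp add: finite_words)
    also have "\<dots> \<le> Suc d"
      using S(4) by (subst card_insert_disjoint) (auto simp: finite_words card_image)
    finally show ?thesis using sub card closed mem(2) by (intro exI[of _ R]) blast
  qed
qed

lemma ex_set_border_le:
  assumes "s \<le> card (words q d)"
  shows "\<exists>S \<subseteq> words q d. card S = s \<and> card (vertex_border (with_proj (word_tree q d)) S) \<le> d"
proof -
  obtain S where S: "S \<subseteq> words q d" "card S = s"
    "\<And>w i. w \<in> S \<Longrightarrow> w @ [i] \<in> words q d \<Longrightarrow> w @ [i] \<in> S"
    "card {w \<in> words q d - S. \<exists>i. w @ [i] \<in> S} \<le> d"
    using ex_descendant_closed_small_border[OF assms] by blast
  \<comment> \<open>By closure under children, no vertex outside \<open>S\<close> has its parent in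
    \<open>S\<close>, so the border consists of parents only.\<close>
  have "butlast w \<notin> S" if "w \<in> words q d - S" "w \<noteq> []" for w
    using S(3)[of "butlast w" "last w"] that by auto
  then have "vertex_border (with_proj (word_tree q d)) S = {w \<in> words q d - S. \<exists>i. w @ [i] \<in> S}"
    unfolding vertex_border_word_tree[OF S(1)] by blast
  then show ?thesis using S by auto
qed

section \<open>A size forcing a large border\<close>

text \<open>The base-\<open>q\<close> digits of the level sizes are all 2. For \<open>q \<ge> 5\<close> this residue is too far from
  0 in both directions to be produced on a level without border vertices.\<close>

fun critical_level :: "nat \<Rightarrow> nat \<Rightarrow> nat" where
  "critical_level q 0 = 0"
| "critical_level q (Suc i) = 2 + q * critical_level q i"

text \<open>For \<open>q \<ge> 3\<close> this is a base-\<open>q\<close> numeral with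
  \<open>i\<close> digits, all 2. It therefore fits into the \<open>q ^ i\<close> vertices of level
  \<open>i\<close>.\<close>

lemma critical_level_less: "3 \<le> q \<Longrightarrow> critical_level q i < q ^ i"
proof (induction i)
  case (Suc i)
  then have "q * Suc (critical_level q i) \<le> q * q ^ i" by (intro mult_le_mono2) simp
  then show ?case using Suc.prems by simp
qed simp

definition critical_size :: "nat \<Rightarrow> nat \<Rightarrow> nat" where
  "critical_size q d = (\<Sum>i\<le>d. critical_level q i)"

lemma card_words: "card (words q d) = (\<Sum>i\<le>d. q ^ i)"
proof (induction d)
  case 0
  have "words q 0 = {[]}" by (auto simp: pverts_word_tree)
  then show ?case by simp
next
  case (Suc d)
  then show ?case
    by (simp only: card_words_Suc sum.atMost_Suc_shift) (simp add: sum_distrib_left)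
qed

lemma critical_size_le: "3 \<le> q \<Longrightarrow> critical_size q d \<le> card (words q d)"
  unfolding critical_size_def card_words
  by (rule sum_mono) (simp add: critical_level_less less_imp_le)

lemma card_eq_sum_length:
  assumes "S \<subseteq> words q d"
  shows "card S = (\<Sum>i\<le>d. card {w \<in> S. length w = i})"
proof -
  have fin: "finite S" using assms finite_words finite_subset by blast
  have "S = (\<Union>i\<le>d. {w \<in> S. length w = i})" using assms by (auto simp: pverts_word_tree)
  then have "card S = card (\<Union>i\<le>d. {w \<in> S. length w = i})" by simp
  also have "\<dots> = (\<Sum>i\<le>d. card {w \<in> S. length w = i})"
    using fin by (intro card_UN_disjoint) auto
  finally show ?thesis .
qed

text \<open>Counting parents and children between consecutive levels bounds the level sizes.
  Subtracting the recurrence of \<open>critical_level\<close> leaves exactly the constant 2 in the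
  bounds on the deviations.\<close>

lemma card_border_ge:
  assumes q: "5 \<le> q" and S: "S \<subseteq> words q d" "card S = critical_size q d"
  shows "d \<le> card (vertex_border (with_proj (word_tree q d)) S)"
proof -
  let ?B = "vertex_border (with_proj (word_tree q d)) S"
  define S' B where "S' i = {w \<in> S. length w = i}" and "B i = {w \<in> ?B. length w = i}" for i
  have B_sub: "?B \<subseteq> words q d" by (auto simp: vertex_border_def)
  have fin: "finite (S' i)" "finite (B i)" for i
    using finite_subset[OF S(1) finite_words] finite_subset[OF B_sub finite_words]
    by (auto simp: S'_def B_def)
  define x where "x i = int (card (S' i)) - int (critical_level q i)" for i
  have "int d \<le> (\<Sum>i\<le>d. int (card (B i)))"
  proof (rule border_counts_sum)
    show "5 \<le> int q" using q by simp
    show "(\<Sum>i\<le>d. x i) = 0"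
      using S(2) card_eq_sum_length[OF S(1)]
      by (simp add: x_def critical_size_def S'_def sum_subtractf flip: of_nat_sum)
    fix i assume i: "i < d"
    \<comment> \<open>The parent of a vertex of \<open>S\<close> lies in \<open>S\<close> or in its
      border.\<close>
    have "S' (Suc i) \<subseteq> (\<lambda>(w, j). w @ [j]) ` ((S' i \<union> B i) \<times> {..<q})"
    proof
      fix v assume v: "v \<in> S' (Suc i)"
      then obtain w j where vw: "v = w @ [j]" by (cases v rule: rev_cases) (auto simp: S'_def)
      then have "w \<in> words q d" "j < q" using v S(1) words_append1_iff by (auto simp: S'_def)
      then have "w \<in> S' i \<union> B i"
        using v vw by (auto simp: S'_def B_def vertex_border_word_tree[OF S(1)])
      then show "v \<in> (\<lambda>(w, j). w @ [j]) ` ((S' i \<union> B i) \<times> {..<q})"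
        using vw \<open>j < q\<close> by auto
    qed
    then have "card (S' (Suc i)) \<le> card ((S' i \<union> B i) \<times> {..<q})"
      by (rule surj_card_le[rotated]) (simp add: fin)
    also have "\<dots> \<le> q * (card (S' i) + card (B i))"
      using card_Un_le[of "S' i" "B i"] by (simp add: card_cartesian_product mult.commute)
    finally have "int (card (S' (Suc i))) \<le> int q * (int (card (S' i)) + int (card (B i)))"
      by (metis of_nat_add of_nat_le_iff of_nat_mult)
    then show "x (Suc i) + 2 \<le> int q * (x i + int (card (B i)))"
      by (simp add: x_def algebra_simps)
    \<comment> \<open>Because \<open>i < d\<close>, every vertex of \<open>S' i\<close> has all
      \<open>q\<close> children, each in \<open>S\<close> or in its border.\<close>
    have "(\<lambda>(w, j). w @ [j]) ` (S' i \<times> {..<q}) \<subseteq> S' (Suc i) \<union> B (Suc i)"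
    proof
      fix v assume "v \<in> (\<lambda>(w, j). w @ [j]) ` (S' i \<times> {..<q})"
      then obtain w j where wj: "v = w @ [j]" "w \<in> S' i" "j < q" by auto
      have "w @ [j] \<in> words q d" using wj S(1) i by (auto simp: words_append1_iff S'_def)
      then show "v \<in> S' (Suc i) \<union> B (Suc i)"
        using wj by (auto simp: S'_def B_def vertex_border_word_tree[OF S(1)])
    qed
    then have "card ((\<lambda>(w, j). w @ [j]) ` (S' i \<times> {..<q})) \<le> card (S' (Suc i) \<union> B (Suc i))"
      using fin by (intro card_mono) auto
    also have "card ((\<lambda>(w, j). w @ [j]) ` (S' i \<times> {..<q})) = q * card (S' i)"
      by (subst card_image) (auto simp: inj_on_def card_cartesian_product)
    also have "card (S' (Suc i) \<union> B (Suc i)) \<le> card (S' (Suc i)) + card (B (Suc i))"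
      by (rule card_Un_le)
    finally have "int q * int (card (S' i)) \<le> int (card (S' (Suc i))) + int (card (B (Suc i)))"
      by (metis of_nat_add of_nat_le_iff of_nat_mult)
    then show "int q * x i \<le> x (Suc i) + 2 + int (card (B (Suc i)))"
      by (simp add: x_def algebra_simps)
  qed simp
  then show ?thesis
    using card_eq_sum_length[OF B_sub] by (simp add: B_def flip: of_nat_sum)
qed

section \<open>The value of the peak\<close>

lemma vertex_iso_peak_word_tree:
  assumes q: "5 \<le> q"
  shows "vertex_iso_peak (with_proj (word_tree q d)) = d"
proof -
  let ?T = "with_proj (word_tree q d)"
  have V: "verts ?T = words q d" by simp
  define C where "C s = {card (vertex_border ?T S) | S. S \<subseteq> verts ?T \<and> card S = s}" for s
  have param: "vertex_iso_param ?T s = Min (C s)" for s by (simp add: vertex_iso_param_def C_def)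
  have fin: "finite (C s)" for s
  proof -
    have "C s \<subseteq> (\<lambda>S. card (vertex_border ?T S)) ` Pow (words q d)" by (auto simp: C_def)
    then show ?thesis using finite_words finite_subset by blast
  qed
  \<comment> \<open>Such a member bounds the minimum from above and also shows that
    \<open>C s\<close> is nonempty.\<close>
  have small: "\<exists>n \<in> C s. n \<le> d" if "s \<le> card (words q d)" for s
    using ex_set_border_le[OF that] unfolding C_def V by blast
  have le: "vertex_iso_param ?T s \<le> d" if "s \<le> card (words q d)" for s
    unfolding param using small[OF that] fin Min_le le_trans by blast
  have cs: "critical_size q d \<le> card (words q d)" using critical_size_le q by simp
  have "d \<le> vertex_iso_param ?T (critical_size q d)"
    unfolding param using small[OF cs] fin card_border_ge[OF q]
    by (subst Min_ge_iff) (auto simp: C_def)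
  then have "vertex_iso_param ?T (critical_size q d) = d" using le[OF cs] by simp
  then show ?thesis
    unfolding vertex_iso_peak_def V using le cs
    by (intro Max_eqI) (auto intro!: exI[of _ "critical_size q d"])
qed

theorem theorem1p4:
  fixes T :: "('a, 'b) pre_digraph" and r :: 'a and q d :: nat
  assumes "q \<ge> 5" and "d \<ge> 0"
    and "complete_qary_tree q d T r"
  shows "vertex_iso_peak T = d"
proof -
  obtain \<phi> where "bij_betw \<phi> (verts (with_proj (word_tree q d))) (verts T)"
    "\<And>u v. u \<in> verts (with_proj (word_tree q d)) \<Longrightarrow> v \<in> verts (with_proj (word_tree q d)) \<Longrightarrow>
      \<phi> u \<rightarrow>\<^bsub>T\<^esub> \<phi> v \<longleftrightarrow> u \<rightarrow>\<^bsub>with_proj (word_tree q d)\<^esub> v"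
    using complete_qary_tree_iso_word_tree[OF assms(3)] by (metis with_proj_simps(1))
  then have "vertex_iso_peak T = vertex_iso_peak (with_proj (word_tree q d))"
    by (rule vertex_iso_peak_cong_bij)
  then show ?thesis using vertex_iso_peak_word_tree[OF assms(1)] by simp
qed

end
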